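(* Let $n\in\mathbb{N}$. For each $\eta\in(0,1)$ the set $\big(\dot{\mathscr{C}}^\eta(\mathbb{R}^n)/_{\sim}\big)\cap\widetilde{\mathrm{BMO}}(\mathbb{R}^n)$ is dense in $\widetilde{\mathrm{VMO}}(\mathbb{R}^n)$.
   Context: All functions are complex-valued. $\mathrm{BMO}(\mathbb{R}^n)$ is the space of $f\in L^1_{\rm loc}(\mathbb{R}^n)$ with $\|f\|_{\mathrm{BMO}(\mathbb{R}^n)}:=\sup_Q|Q|^{-1}\int_Q|f-f_Q|\,dx<\infty$, the supremum being over all cubes $Q\subset\mathbb{R}^n$ with sides parallel to the axes, where $f_Q:=|Q|^{-1}\int_Qf$. $\mathrm{VMO}(\mathbb{R}^n)$ is the space of $f\in\mathrm{BMO}(\mathbb{R}^n)$ with $\lim_{r\to0^+}\sup_{\ell(Q)\le r}|Q|^{-1}\int_Q|f-f_Q|\,dx=0$, where $\ell(Q)$ is the side-length of $Q$. $\dot{\mathscr{C}}^\eta(\mathbb{R}^n)$ is the homogeneous H\"older space of functions with $\sup_{x\ne y}|f(x)-f(y)|/|x-y|^\eta<\infty$. For measurable $f$, $[f]$ denotes its equivalence class under $f\sim g$ iff $f-g$ is a.e. constant. $\widetilde{\mathrm{BMO}}(\mathbb{R}^n):=\{[f]:f\in\mathrm{BMO}(\mathbb{R}^n)\}$ is a Banach space with norm $\|[f]\|:=\|f\|_{\mathrm{BMO}(\mathbb{R}^n)}$, and $\widetilde{\mathrm{VMO}}(\mathbb{R}^n):=\{[f]:f\in\mathrm{VMO}(\mathbb{R}^n)\}$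 is a closed subspace of it. $\dot{\mathscr{C}}^\eta(\mathbb{R}^n)/_{\sim}:=\{[f]:f\in\dot{\mathscr{C}}^\eta(\mathbb{R}^n)\}$; its intersection with $\widetilde{\mathrm{BMO}}(\mathbb{R}^n)$ is $\{[f]:f\in\dot{\mathscr{C}}^\eta(\mathbb{R}^n)\cap\mathrm{BMO}(\mathbb{R}^n)\}$. *)

theory Defs
  imports "HOL-Analysis.Analysis"
begin

definition cube :: "real ^ 'n \<Rightarrow> real \<Rightarrow> (real ^ 'n) set" where
  "cube a l = cbox a (\<chi> i. a $ i + l)"

definition L1_loc :: "(real ^ 'n \<Rightarrow> complex) set" where
  "L1_loc = {f. \<forall>K. compact K \<longrightarrow> f absolutely_integrable_on K}"

definition mean :: "(real ^ 'n \<Rightarrow> complex) \<Rightarrow> (real ^ 'n) set \<Rightarrow> complex" where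
  "mean f Q = (LINT x:Q|lebesgue. f x) /\<^sub>R measure lebesgue Q"

definition mean_osc :: "(real ^ 'n \<Rightarrow> complex) \<Rightarrow> (real ^ 'n) set \<Rightarrow> real" where
  "mean_osc f Q = (LINT x:Q|lebesgue. cmod (f x - mean f Q)) / measure lebesgue Q"

(* The suprema below are taken in the reals, where Sup is only meaningful on nonempty bounded
   sets; membership in BMO (which includes bounded mean oscillation) guarantees this. *)
definition BMO :: "(real ^ 'n \<Rightarrow> complex) set" where
  "BMO = {f \<in> L1_loc. bdd_above {mean_osc f (cube a l) | a l. 0 < l}}"

definition BMO_norm :: "(real ^ 'n \<Rightarrow> complex) \<Rightarrow> real" where
  "BMO_norm f = Sup {mean_osc f (cube a l) | a l. 0 < l}"

definition VMO :: "(real ^ 'n \<Rightarrow> complex) set" where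
  "VMO = {f \<in> BMO. ((\<lambda>r. Sup {mean_osc f (cube a l) | a l. 0 < l \<and> l \<le> r}) \<longlongrightarrow> 0) (at_right 0)}"

definition Holder_hom :: "real \<Rightarrow> (real ^ 'n \<Rightarrow> complex) set" where
  "Holder_hom \<eta> = {f. bdd_above {cmod (f x - f y) / norm (x - y) powr \<eta> | x y. x \<noteq> y}}"

definition ae_class :: "(real ^ 'n \<Rightarrow> complex) \<Rightarrow> (real ^ 'n \<Rightarrow> complex) set" where
  "ae_class f = {g \<in> borel_measurable lebesgue. \<exists>c. AE x in lebesgue. f x - g x = c}"

definition BMO_tilde :: "(real ^ 'n \<Rightarrow> complex) set set" where
  "BMO_tilde = ae_class ` BMO"

definition VMO_tilde :: "(real ^ 'n \<Rightarrow> complex) set set" where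
  "VMO_tilde = ae_class ` VMO"

definition Holder_tilde :: "real \<Rightarrow> (real ^ 'n \<Rightarrow> complex) set set" where
  "Holder_tilde \<eta> = ae_class ` Holder_hom \<eta>"

definition class_diff ::
    "(real ^ 'n \<Rightarrow> complex) set \<Rightarrow> (real ^ 'n \<Rightarrow> complex) set \<Rightarrow> (real ^ 'n \<Rightarrow> complex) set" where
  "class_diff X Y = {(\<lambda>x. f x - g x) | f g. f \<in> X \<and> g \<in> Y}"

(* The choice of representative is immaterial: see BMO_tilde_norm_class. *)
definition BMO_tilde_norm :: "(real ^ 'n \<Rightarrow> complex) set \<Rightarrow> real" where
  "BMO_tilde_norm X = BMO_norm (SOME f. f \<in> X)"

(* The value 0 off BMO_tilde is needed because Metric_space demands a nonnegative and
   symmetric distance on the whole type. *)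
definition BMO_tilde_dist ::
    "(real ^ 'n \<Rightarrow> complex) set \<Rightarrow> (real ^ 'n \<Rightarrow> complex) set \<Rightarrow> real" where
  "BMO_tilde_dist X Y =
    (if X \<in> BMO_tilde \<and> Y \<in> BMO_tilde then BMO_tilde_norm (class_diff X Y) else 0)"

(* Metric_space_BMO_tilde shows that this is a genuine metric topology. *)
definition BMO_tilde_topology :: "(real ^ 'n \<Rightarrow> complex) set topology" where
  "BMO_tilde_topology = Metric_space.mtopology BMO_tilde BMO_tilde_dist"

lemma L1_loc_measurable:
  fixes f :: "real ^ 'n \<Rightarrow> complex"
  assumes "f \<in> L1_loc" shows "f \<in> borel_measurable lebesgue"
proof -
  have "(\<lambda>x. indicator (cball 0 (real k)) x *\<^sub>R f x) \<in> borel_measurable lebesgue" for k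
  proof (rule borel_measurable_integrable)
    have "compact (cball (0 :: real ^ 'n) (real k))" by (rule compact_cball)
    then have "f absolutely_integrable_on cball 0 (real k)"
      using assms by (simp add: L1_loc_def)
    then show "integrable lebesgue (\<lambda>x. indicator (cball 0 (real k)) x *\<^sub>R f x)"
      by (simp only: set_integrable_def)
  qed
  moreover have "(\<lambda>k. indicator (cball 0 (real k)) x *\<^sub>R f x) \<longlonglongrightarrow> f x" for x
  proof (rule tendsto_eventually)
    obtain N where N: "norm x \<le> real N" using real_arch_simple by blast
    show "\<forall>\<^sub>F k in sequentially. indicator (cball 0 (real k)) x *\<^sub>R f x = f x"
      using eventually_ge_at_top[of N]
      by eventually_elim (use N in \<open>auto simp: indicator_def\<close>)
  qed
  ultimately show ?thesis by (rule borel_measurable_LIMSEQ_metric)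
qed

lemma ae_class_self: "f \<in> borel_measurable lebesgue \<Longrightarrow> f \<in> ae_class f"
  unfolding ae_class_def by (auto intro!: exI[of _ 0])

lemma ae_class_eq:
  assumes "g \<in> ae_class f" shows "ae_class g = ae_class f"
proof -
  obtain c where c: "AE x in lebesgue. f x - g x = c" using assms by (auto simp: ae_class_def)
  show ?thesis
  proof (intro set_eqI iffI)
    fix h assume h: "h \<in> ae_class g"
    then obtain d where d: "AE x in lebesgue. g x - h x = d" by (auto simp: ae_class_def)
    have "AE x in lebesgue. f x - h x = c + d" using c d by eventually_elim auto
    then show "h \<in> ae_class f" using h by (auto simp: ae_class_def)
  next
    fix h assume h: "h \<in> ae_class f"
    then obtain d where d: "AE x in lebesgue. f x - h x = d" by (auto simp: ae_class_def)
    have "AE x in lebesgue. g x - h x = d - c" using c d by eventually_elim auto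
    then show "h \<in> ae_class g" using h by (auto simp: ae_class_def)
  qed
qed

lemma class_diff_ae_class:
  assumes "f \<in> borel_measurable lebesgue" "g \<in> borel_measurable lebesgue"
  shows "class_diff (ae_class f) (ae_class g) = ae_class (\<lambda>x. f x - g x)"
proof (intro set_eqI iffI)
  fix h assume "h \<in> class_diff (ae_class f) (ae_class g)"
  then obtain f' g' where h: "h = (\<lambda>x. f' x - g' x)" and fg: "f' \<in> ae_class f" "g' \<in> ae_class g"
    by (auto simp: class_diff_def)
  then obtain c d where c: "AE x in lebesgue. f x - f' x = c" and d: "AE x in lebesgue. g x - g' x = d"
    by (auto simp: ae_class_def)
  have "AE x in lebesgue. (f x - g x) - h x = c - d"
    using c d by eventually_elim (auto simp: h algebra_simps)
  then show "h \<in> ae_class (\<lambda>x. f x - g x)" using fg by (auto simp: ae_class_def h)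
next
  fix h assume h: "h \<in> ae_class (\<lambda>x. f x - g x)"
  then obtain c where c: "AE x in lebesgue. (f x - g x) - h x = c" by (auto simp: ae_class_def)
  have "AE x in lebesgue. f x - (h x + g x) = c" using c by eventually_elim (auto simp: algebra_simps)
  then have "(\<lambda>x. h x + g x) \<in> ae_class f" using h assms by (auto simp: ae_class_def)
  moreover have "g \<in> ae_class g" using assms by (auto intro: ae_class_self)
  ultimately show "h \<in> class_diff (ae_class f) (ae_class g)"
    unfolding class_diff_def mem_Collect_eq by (intro exI[of _ "\<lambda>x. h x + g x"] exI[of _ g]) simp
qed

lemma cube_facts:
  fixes a :: "real ^ 'n"
  assumes "0 < l"
  shows "compact (cube a l)" "cube a l \<in> sets lebesgue" "0 < measure lebesgue (cube a l)"
    "cube a l \<in> lmeasurable"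
proof -
  have "a \<in> cbox a (\<chi> i. a $ i + l)" using assms by (auto simp: mem_box_cart)
  then have "measure lborel (cbox a (\<chi> i. a $ i + l)) = (\<Prod>i\<in>(UNIV :: 'n set). l)"
    by (subst content_cbox_cart) auto
  then show "0 < measure lebesgue (cube a l)" using assms by (simp add: cube_def)
qed (auto simp: cube_def)

lemma L1_loc_cube: "f \<in> L1_loc \<Longrightarrow> 0 < l \<Longrightarrow> set_integrable lebesgue (cube a l) f"
  using cube_facts(1) by (auto simp: L1_loc_def)

lemma cube_const: "0 < l \<Longrightarrow> set_integrable lebesgue (cube a l) (\<lambda>x. c :: complex)"
  using cube_facts(4)[of l a] by (simp add: set_integrable_def lmeasurable_iff_integrable)

lemma mean_diff:
  assumes "f \<in> L1_loc" "g \<in> L1_loc" "0 < l"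
  shows "mean (\<lambda>x. f x - g x) (cube a l) = mean f (cube a l) - mean g (cube a l)"
  using L1_loc_cube[OF assms(1,3)] L1_loc_cube[OF assms(2,3)]
  by (simp add: mean_def set_integral_diff scaleR_diff_right)

lemma osc_integrable:
  assumes "f \<in> L1_loc" "0 < l"
  shows "set_integrable lebesgue (cube a l) (\<lambda>x. cmod (f x - c))"
  using L1_loc_cube[OF assms] cube_const[OF assms(2)]
  by (intro set_integrable_norm set_integral_diff)

lemma mean_osc_nonneg: "0 \<le> mean_osc f Q"
  unfolding mean_osc_def set_lebesgue_integral_def by (auto intro!: divide_nonneg_nonneg Bochner_Integration.integral_nonneg)

lemma L1_loc_diff: "f \<in> L1_loc \<Longrightarrow> g \<in> L1_loc \<Longrightarrow> (\<lambda>x. f x - g x) \<in> L1_loc"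
  unfolding L1_loc_def by (auto intro: set_integral_diff)

lemma mean_osc_diff:
  assumes "f \<in> L1_loc" "g \<in> L1_loc" "0 < l"
  shows "mean_osc (\<lambda>x. f x - g x) (cube a l) \<le> mean_osc f (cube a l) + mean_osc g (cube a l)"
proof -
  let ?Q = "cube a l"
  note I = osc_integrable[OF assms(1,3), of a] osc_integrable[OF assms(2,3), of a]
    osc_integrable[OF L1_loc_diff[OF assms(1,2)] assms(3), of a]
  have "(LINT x:?Q|lebesgue. cmod (f x - g x - mean (\<lambda>x. f x - g x) ?Q))
     \<le> (LINT x:?Q|lebesgue. cmod (f x - mean f ?Q) + cmod (g x - mean g ?Q))"
  proof (rule set_integral_mono)
    fix x
    have "f x - g x - mean (\<lambda>x. f x - g x) ?Q = (f x - mean f ?Q) - (g x - mean g ?Q)"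
      using mean_diff[OF assms] by simp
    then show "cmod (f x - g x - mean (\<lambda>x. f x - g x) ?Q) \<le> cmod (f x - mean f ?Q) + cmod (g x - mean g ?Q)"
      by (metis norm_triangle_ineq4)
  qed (intro I set_integral_add)+
  also have "\<dots> = (LINT x:?Q|lebesgue. cmod (f x - mean f ?Q)) + (LINT x:?Q|lebesgue. cmod (g x - mean g ?Q))"
    by (intro set_integral_add I)
  finally show ?thesis using cube_facts(3)[OF assms(3), of a]
    by (simp add: mean_osc_def divide_simps)
qed

lemma mean_osc_le_norm: "f \<in> BMO \<Longrightarrow> 0 < l \<Longrightarrow> mean_osc f (cube a l) \<le> BMO_norm f"
  unfolding BMO_norm_def BMO_def by (intro cSup_upper) auto

lemma BMO_norm_least:
  fixes f :: "real ^ 'n \<Rightarrow> complex"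
  assumes "\<And>a l. 0 < l \<Longrightarrow> mean_osc f (cube a l) \<le> B"
  shows "BMO_norm f \<le> B"
  unfolding BMO_norm_def
proof (rule cSup_least)
  show "{mean_osc f (cube a l) |a l. 0 < l} \<noteq> {}" using zero_less_one by blast
qed (use assms in auto)

lemma BMO_norm_nonneg: "f \<in> BMO \<Longrightarrow> 0 \<le> BMO_norm f"
  using mean_osc_nonneg mean_osc_le_norm[of f 1] by (metis order_trans zero_less_one)

lemma BMO_diff:
  assumes "f \<in> BMO" "g \<in> BMO"
  shows "(\<lambda>x. f x - g x) \<in> BMO" "BMO_norm (\<lambda>x. f x - g x) \<le> BMO_norm f + BMO_norm g"
proof -
  have L: "f \<in> L1_loc" "g \<in> L1_loc" using assms by (auto simp: BMO_def)
  have *: "mean_osc (\<lambda>x. f x - g x) (cube a l) \<le> BMO_norm f + BMO_norm g" if "0 < l" for a l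
    using mean_osc_diff[OF L that, of a] mean_osc_le_norm[OF assms(1) that, of a]
      mean_osc_le_norm[OF assms(2) that, of a] by linarith
  show "(\<lambda>x. f x - g x) \<in> BMO"
    using * L1_loc_diff[OF L] by (auto simp: BMO_def intro!: bdd_aboveI[where M="BMO_norm f + BMO_norm g"])
  show "BMO_norm (\<lambda>x. f x - g x) \<le> BMO_norm f + BMO_norm g"
    using * by (rule BMO_norm_least)
qed

lemma ae_const_diff:
  fixes f g :: "real ^ 'n \<Rightarrow> complex"
  assumes f: "f \<in> L1_loc" and g: "g \<in> ae_class f"
  shows "g \<in> L1_loc" "0 < l \<Longrightarrow> mean_osc g (cube a l) = mean_osc f (cube a l)"
proof -
  obtain c where c: "AE x in lebesgue. f x - g x = c" and gm: "g \<in> borel_measurable lebesgue"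
    using g by (auto simp: ae_class_def)
  have eq: "AE x in lebesgue. g x = f x - c" using c by eventually_elim auto
  have ci: "(\<lambda>x. c) absolutely_integrable_on K" if "compact K" for K :: "(real ^ 'n) set"
    using that by (simp add: set_integrable_def lmeasurable_compact flip: lmeasurable_iff_integrable)
  show gL: "g \<in> L1_loc"
    unfolding L1_loc_def
  proof safe
    fix K :: "(real ^ 'n) set" assume K: "compact K"
    have "(\<lambda>x. f x - c) absolutely_integrable_on K"
      using f ci[OF K] K by (auto simp: L1_loc_def intro: set_integral_diff)
    moreover have "K \<in> sets lebesgue" using K by (simp add: lmeasurable_compact fmeasurableD)
    ultimately show "g absolutely_integrable_on K"
      by (subst set_integrable_cong_AE[where g="\<lambda>x. f x - c"])
        (use gm L1_loc_measurable[OF f] eq in auto)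
  qed
  assume l: "0 < l"
  let ?Q = "cube a l"
  note Q = cube_facts[OF l, of a]
  have fm: "f \<in> borel_measurable lebesgue" by (rule L1_loc_measurable[OF f])
  have "(LINT x:?Q|lebesgue. g x) = (LINT x:?Q|lebesgue. f x - c)"
    using eq gm fm Q by (intro set_lebesgue_integral_cong_AE) auto
  also have "\<dots> = (LINT x:?Q|lebesgue. f x) - measure lebesgue ?Q *\<^sub>R c"
  proof -
    have "emeasure lebesgue ?Q \<noteq> \<infinity>"
      unfolding infinity_ennreal_def by (rule fmeasurableD2[OF Q(4)])
    from set_integral_const[OF Q(2) this, of c] show ?thesis
      by (simp only: set_integral_diff(2)[OF L1_loc_cube[OF f l, of a] cube_const[OF l, of a c]])
  qed
  finally have m: "mean g ?Q = mean f ?Q - c"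
    using Q by (simp add: mean_def scaleR_diff_right)
  have "(LINT x:?Q|lebesgue. cmod (g x - mean g ?Q)) = (LINT x:?Q|lebesgue. cmod (f x - mean f ?Q))"
  proof (rule set_lebesgue_integral_cong_AE)
    show "AE x\<in>?Q in lebesgue. cmod (g x - mean g ?Q) = cmod (f x - mean f ?Q)"
      using eq by eventually_elim (auto simp: m)
  qed (use fm gm Q in auto)
  then show "mean_osc g ?Q = mean_osc f ?Q" by (simp add: mean_osc_def)
qed

lemma BMO_ae_class:
  assumes "f \<in> BMO" "g \<in> ae_class f"
  shows "g \<in> BMO" "BMO_norm g = BMO_norm f"
proof -
  have f: "f \<in> L1_loc" using assms by (simp add: BMO_def)
  have "{mean_osc g (cube a l) | a l. 0 < l} = {mean_osc f (cube a l) | a l. 0 < l}"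
  proof -
    have "(t = mean_osc g (cube a l) \<and> 0 < l) = (t = mean_osc f (cube a l) \<and> 0 < l)" for t a l
      using ae_const_diff(2)[OF f assms(2), of l a] by auto
    then show ?thesis by (simp only:)
  qed
  then show "g \<in> BMO" "BMO_norm g = BMO_norm f"
    using assms(1) ae_const_diff(1)[OF f assms(2)]
    unfolding BMO_def BMO_norm_def mem_Collect_eq by (simp_all only: simp_thms)
qed

lemma BMO_tilde_norm_class:
  assumes "f \<in> BMO" shows "BMO_tilde_norm (ae_class f) = BMO_norm f"
proof -
  have "f \<in> ae_class f" using assms by (auto simp: BMO_def intro: ae_class_self L1_loc_measurable)
  then have "(SOME g. g \<in> ae_class f) \<in> ae_class f"
    by (rule someI[where P = "\<lambda>g. g \<in> ae_class f"])
  then show ?thesis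
    unfolding BMO_tilde_norm_def by (rule BMO_ae_class(2)[OF assms])
qed

lemma BMO_tilde_dist_class:
  assumes "f \<in> BMO" "g \<in> BMO"
  shows "BMO_tilde_dist (ae_class f) (ae_class g) = BMO_norm (\<lambda>x. f x - g x)"
proof -
  have "f \<in> borel_measurable lebesgue" "g \<in> borel_measurable lebesgue"
    using assms by (auto simp: BMO_def intro: L1_loc_measurable)
  then have "class_diff (ae_class f) (ae_class g) = ae_class (\<lambda>x. f x - g x)"
    by (rule class_diff_ae_class)
  moreover have "ae_class f \<in> BMO_tilde" "ae_class g \<in> BMO_tilde"
    unfolding BMO_tilde_def by (rule imageI[OF assms(1)], rule imageI[OF assms(2)])
  ultimately show ?thesis
    unfolding BMO_tilde_dist_def using BMO_tilde_norm_class[OF BMO_diff(1)[OF assms]] by (simp only: if_True simp_thms)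
qed

lemma BMO_norm_zero:
  fixes f :: "real ^ 'n \<Rightarrow> complex"
  assumes f: "f \<in> BMO" and 0: "BMO_norm f = 0"
  shows "\<exists>c. AE x in lebesgue. f x = c"
proof -
  have fL: "f \<in> L1_loc" using f by (simp add: BMO_def)
  have ae: "AE x in lebesgue. x \<in> cube a l \<longrightarrow> f x = mean f (cube a l)" if l: "0 < l" for a l
  proof -
    let ?Q = "cube a l"
    have "mean_osc f ?Q = 0"
      using mean_osc_le_norm[OF f l, of a] mean_osc_nonneg[of f ?Q] 0 by simp
    then have "(LINT x:?Q|lebesgue. cmod (f x - mean f ?Q)) = 0"
      using cube_facts(3)[OF l, of a] by (simp add: mean_osc_def)
    then have "(LINT x|lebesgue. indicator ?Q x *\<^sub>R cmod (f x - mean f ?Q)) = 0"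
      by (simp add: set_lebesgue_integral_def)
    moreover have "integrable lebesgue (\<lambda>x. indicator ?Q x *\<^sub>R cmod (f x - mean f ?Q))"
      using osc_integrable[OF fL l, of a] unfolding set_integrable_def .
    ultimately have "AE x in lebesgue. indicator ?Q x *\<^sub>R cmod (f x - mean f ?Q) = 0"
      by (subst (asm) integral_nonneg_eq_0_iff_AE) auto
    then show ?thesis by eventually_elim (auto simp: indicator_def)
  qed
  define Q :: "nat \<Rightarrow> (real ^ 'n) set" where "Q k = cube (\<chi> i. - real (Suc k)) (2 * real (Suc k))" for k :: nat
  have Q_mem: "x \<in> Q k \<longleftrightarrow> (\<forall>i. \<bar>x $ i\<bar> \<le> real (Suc k))" for x :: "real ^ 'n" and k
  proof -
    have "(- real (Suc k) \<le> x $ i \<and> x $ i \<le> - real (Suc k) + 2 * real (Suc k)) \<longleftrightarrow> \<bar>x $ i\<bar> \<le> real (Suc k)" for i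
      by (auto simp: abs_le_iff)
    then show ?thesis unfolding Q_def cube_def mem_box_cart by simp
  qed
  have aeQ: "AE x in lebesgue. x \<in> Q k \<longrightarrow> f x = mean f (Q k)" for k
    unfolding Q_def by (rule ae) auto
  have m: "mean f (Q k) = mean f (Q 0)" for k
  proof (rule ccontr)
    assume "mean f (Q k) \<noteq> mean f (Q 0)"
    have "AE x in lebesgue. x \<notin> Q 0"
      using aeQ[of k] aeQ[of 0]
    proof eventually_elim
      case (elim x)
      have "x \<in> Q 0 \<Longrightarrow> x \<in> Q k" unfolding Q_mem by (auto intro: order_trans)
      then show ?case using elim \<open>mean f (Q k) \<noteq> mean f (Q 0)\<close> by auto
    qed
    moreover have "0 < measure lebesgue (Q 0)" "Q 0 \<in> sets lebesgue"
      unfolding Q_def by (auto intro!: cube_facts)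
    ultimately show False
      by (simp add: AE_iff_null_sets[symmetric] measure_eq_0_null_sets)
  qed
  have "AE x in lebesgue. \<forall>k. x \<in> Q k \<longrightarrow> f x = mean f (Q k)"
    using aeQ by (simp add: AE_all_countable)
  then have "AE x in lebesgue. f x = mean f (Q 0)"
  proof eventually_elim
    case (elim x)
    obtain k where k: "norm x \<le> real k" using real_arch_simple by blast
    have "x \<in> Q k" unfolding Q_mem
    proof
      fix i show "\<bar>x $ i\<bar> \<le> real (Suc k)" using k component_le_norm_cart[of x i] by simp
    qed
    then show ?case using elim m[of k] by auto
  qed
  then show ?thesis by blast
qed

lemma Metric_space_BMO_tilde:
  "Metric_space (BMO_tilde :: (real ^ 'n \<Rightarrow> complex) set set) BMO_tilde_dist"
proof -
  have z: "(\<lambda>x :: real ^ 'n. 0 :: complex) \<in> BMO \<and> BMO_norm (\<lambda>x :: real ^ 'n. 0 :: complex) = 0"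
  proof -
    have "mean_osc (\<lambda>x :: real ^ 'n. 0) Q = 0" for Q
      by (simp add: mean_osc_def mean_def set_lebesgue_integral_def)
    moreover have "\<exists>l :: real. 0 < l" using zero_less_one by blast
    ultimately have "{mean_osc (\<lambda>x :: real ^ 'n. 0) (cube a l) | a l. 0 < l} = {0}" by simp
    then show ?thesis
      unfolding BMO_def BMO_norm_def by (simp add: L1_loc_def set_integrable_def)
  qed
  have swap: "BMO_norm (\<lambda>x. f x - g x) = BMO_norm (\<lambda>x. g x - f x)"
    if fg: "f \<in> BMO" "g \<in> BMO" for f g :: "real ^ 'n \<Rightarrow> complex"
  proof -
    have "BMO_norm (\<lambda>x. u x - v x) \<le> BMO_norm (\<lambda>x. v x - u x)"
      if "u \<in> BMO" "v \<in> BMO" for u v :: "real ^ 'n \<Rightarrow> complex"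
      using BMO_diff(2)[OF conjunct1[OF z] BMO_diff(1)[OF that(2,1)]] z by simp
    then show ?thesis using fg by (intro antisym)
  qed
  show ?thesis
  proof
    fix X Y :: "(real ^ 'n \<Rightarrow> complex) set"
    have "0 \<le> BMO_tilde_dist X Y \<and> BMO_tilde_dist X Y = BMO_tilde_dist Y X"
    proof (cases "X \<in> BMO_tilde \<and> Y \<in> BMO_tilde")
      case True
      then obtain f g where fg: "f \<in> BMO" "g \<in> BMO" "X = ae_class f" "Y = ae_class g"
        by (auto simp: BMO_tilde_def)
      then show ?thesis
        using BMO_norm_nonneg[OF BMO_diff(1)[OF fg(1,2)]] swap[OF fg(1,2)]
        by (simp add: BMO_tilde_dist_class)
    qed (auto simp: BMO_tilde_dist_def)
    then show "0 \<le> BMO_tilde_dist X Y" "BMO_tilde_dist X Y = BMO_tilde_dist Y X" by auto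
  next
    fix X Y :: "(real ^ 'n \<Rightarrow> complex) set"
    assume "X \<in> BMO_tilde" "Y \<in> BMO_tilde"
    then obtain f g where fg: "f \<in> BMO" "g \<in> BMO" "X = ae_class f" "Y = ae_class g"
      by (auto simp: BMO_tilde_def)
    have d: "BMO_tilde_dist X Y = BMO_norm (\<lambda>x. f x - g x)"
      using fg by (simp add: BMO_tilde_dist_class)
    show "BMO_tilde_dist X Y = 0 \<longleftrightarrow> X = Y"
    proof
      assume "BMO_tilde_dist X Y = 0"
      then have "\<exists>c. AE x in lebesgue. f x - g x = c"
        using BMO_norm_zero[OF BMO_diff(1)[OF fg(1,2)]] d by simp
      then have "g \<in> ae_class f"
        using fg(2) by (auto simp: ae_class_def BMO_def intro: L1_loc_measurable)
      then show "X = Y" using fg ae_class_eq by blast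
    next
      assume "X = Y"
      then have "BMO_tilde_dist X Y = BMO_norm (\<lambda>x. f x - f x)"
        using fg BMO_tilde_dist_class[of f f] by simp
      then show "BMO_tilde_dist X Y = 0" using z by simp
    qed
  next
    fix X Y Z :: "(real ^ 'n \<Rightarrow> complex) set"
    assume "X \<in> BMO_tilde" "Y \<in> BMO_tilde" "Z \<in> BMO_tilde"
    then obtain f g h where fg: "f \<in> BMO" "g \<in> BMO" "h \<in> BMO"
        "X = ae_class f" "Y = ae_class g" "Z = ae_class h"
      by (auto simp: BMO_tilde_def)
    have "BMO_norm (\<lambda>x. f x - h x) = BMO_norm (\<lambda>x. (f x - g x) - (h x - g x))" by simp
    also have "\<dots> \<le> BMO_norm (\<lambda>x. f x - g x) + BMO_norm (\<lambda>x. h x - g x)"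
      by (intro BMO_diff fg)
    finally show "BMO_tilde_dist X Z \<le> BMO_tilde_dist X Y + BMO_tilde_dist Y Z"
      using fg swap[OF fg(2,3)] by (simp add: BMO_tilde_dist_class)
  qed
qed

end

theory Submission
  imports Defs
begin

text \<open>
  A function \<open>f\<close> in VMO is approximated by its convolution \<open>f\<^sub>t\<close> with a normalised Lipschitz bump
  supported in the ball of radius \<open>t\<close>. Subtracting the mean of \<open>f\<close> over a cube of side comparable
  to \<open>t\<close> shows that \<open>f\<^sub>t\<close> differs from that mean, and varies on scale \<open>t\<close>, by at most a constant
  times the mean oscillation of \<open>f\<close> there. Hence \<open>f - f\<^sub>t\<close> has small mean modulus on cubes of side
  comparable to \<open>t\<close>, and on larger cubes by subdivision; smaller cubes are controlled because
  \<open>f\<close> and \<open>f\<^sub>t\<close> both oscillate little there. Comparing the mollifications at the scales \<open>t\<close>, \<open>2t\<close>, \<open>4t\<close>, and so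
  on shows that \<open>f\<^sub>t\<close> is Lipschitz at small distances and grows logarithmically at large ones, so it
  is Hoelder continuous of every order below one.
\<close>

section \<open>Cubes, mean oscillation and weighted integrals\<close>

lemma measure_cube:
  fixes a :: "real ^ 'n"
  assumes "0 \<le> l" shows "measure lebesgue (cube a l) = l ^ CARD('n)"
proof -
  have "a \<in> cbox a (\<chi> i. a $ i + l)" using assms by (auto simp: mem_box_cart)
  then have "measure lborel (cbox a (\<chi> i. a $ i + l)) = (\<Prod>i\<in>(UNIV :: 'n set). l)"
    by (subst content_cbox_cart) auto
  then show ?thesis by (simp add: cube_def)
qed

lemma mem_cube: "x \<in> cube a l \<longleftrightarrow> (\<forall>i. a $ i \<le> x $ i \<and> x $ i \<le> a $ i + l)"
  by (simp add: cube_def mem_box_cart)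

lemma cball_subset_cube:
  fixes x :: "real ^ 'n"
  assumes "\<And>i. a $ i + t \<le> x $ i" "\<And>i. x $ i + t \<le> a $ i + l"
  shows "cball x t \<subseteq> cube a l"
proof
  fix z assume "z \<in> cball x t"
  then have "norm (z - x) \<le> t" by (simp add: dist_norm norm_minus_commute)
  then have "\<bar>z $ i - x $ i\<bar> \<le> t" for i
    using component_le_norm_cart[of "z - x" i] by simp
  then show "z \<in> cube a l"
    unfolding mem_cube using assms by (smt (verit))
qed

lemma integral_osc:
  fixes f :: "real ^ 'n \<Rightarrow> complex"
  assumes "0 < l"
  shows "(LINT x:cube a l|lebesgue. cmod (f x - mean f (cube a l)))
    = l ^ CARD('n) * mean_osc f (cube a l)"
  using assms by (simp add: mean_osc_def measure_cube)

text \<open>The distance from the mean to \<open>c\<close> is at most the average of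
  \<open>cmod (f x - c)\<close>, so trading the mean for any convenient constant costs a factor
  2.\<close>

lemma mean_osc_le_integral:
  fixes f :: "real ^ 'n \<Rightarrow> complex"
  assumes f: "f \<in> L1_loc" and l: "0 < l"
  shows "mean_osc f (cube a l) \<le> 2 * (LINT x:cube a l|lebesgue. cmod (f x - c)) / l ^ CARD('n)"
proof -
  let ?Q = "cube a l" and ?V = "l ^ CARD('n)"
  let ?I = "LINT x:?Q|lebesgue. cmod (f x - c)"
  have V: "?V > 0" using l by simp
  have em: "emeasure lebesgue ?Q \<noteq> \<infinity>"
    unfolding infinity_ennreal_def by (rule fmeasurableD2[OF cube_facts(4)[OF l]])
  have const: "(LINT x:?Q|lebesgue. d) = ?V *\<^sub>R d" for d :: "'b :: {banach, second_countable_topology}"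
    using set_integral_const[OF cube_facts(2)[OF l] em, of d] l by (simp add: measure_cube)
  have "(LINT x:?Q|lebesgue. f x - c) = (LINT x:?Q|lebesgue. f x) - ?V *\<^sub>R c"
    using set_integral_diff(2)[OF L1_loc_cube[OF f l, of a] cube_const[OF l, of a c]] const[of c] by simp
  also have "\<dots> = ?V *\<^sub>R (mean f ?Q - c)"
    using V l by (simp add: mean_def measure_cube scaleR_diff_right)
  finally have "?V * cmod (mean f ?Q - c) = cmod (LINT x:?Q|lebesgue. f x - c)"
    using V by simp
  also have "\<dots> \<le> ?I"
    using L1_loc_cube[OF f l, of a] cube_const[OF l, of a c]
    by (intro set_integral_norm_bound set_integral_diff)
  finally have m: "?V * cmod (mean f ?Q - c) \<le> ?I" .
  have ci: "set_integrable lebesgue ?Q (\<lambda>x. cmod (mean f ?Q - c))"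
    using set_integrable_norm[OF cube_const[OF l, of a "mean f ?Q - c"]] by simp
  have "?V * mean_osc f ?Q = (LINT x:?Q|lebesgue. cmod (f x - mean f ?Q))"
    using integral_osc[OF l] by metis
  also have "\<dots> \<le> (LINT x:?Q|lebesgue. cmod (f x - c) + cmod (mean f ?Q - c))"
  proof (rule set_integral_mono)
    fix x
    have "f x - mean f ?Q = (f x - c) - (mean f ?Q - c)" by simp
    then show "cmod (f x - mean f ?Q) \<le> cmod (f x - c) + cmod (mean f ?Q - c)"
      by (metis norm_triangle_ineq4)
  qed (intro set_integral_add osc_integrable[OF f l] ci)+
  also have "\<dots> = ?I + ?V * cmod (mean f ?Q - c)"
    using const[of "cmod (mean f ?Q - c)"]
    by (simp add: set_integral_add[OF osc_integrable[OF f l] ci])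
  also have "\<dots> \<le> 2 * ?I" using m by simp
  finally show ?thesis using V by (simp add: field_simps)
qed

text \<open>Serves both a single tent, where \<open>B\<close> is its height, and the difference of
  two tents, where \<open>B\<close> is the distance of their centres.\<close>

lemma weighted_integral_bound:
  fixes f :: "real ^ 'n \<Rightarrow> complex" and w :: "real ^ 'n \<Rightarrow> real"
  assumes f: "f \<in> L1_loc" and l: "0 < l" and w: "w \<in> borel_measurable borel"
    and B: "\<And>z. \<bar>w z\<bar> \<le> B" and supp: "\<And>z. z \<notin> cube a l \<Longrightarrow> w z = 0"
  shows "integrable lebesgue (\<lambda>z. w z *\<^sub>R (f z - c))"
    and "cmod (LINT z|lebesgue. w z *\<^sub>R (f z - c)) \<le> B * (LINT z:cube a l|lebesgue. cmod (f z - c))"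
proof -
  let ?g = "\<lambda>z. B * (indicator (cube a l) z *\<^sub>R cmod (f z - c))"
  have B0: "0 \<le> B" using B[of undefined] by (rule order_trans[OF abs_ge_zero])
  have ig: "integrable lebesgue ?g"
    using osc_integrable[OF f l, of a c] unfolding set_integrable_def by (rule integrable_mult_right)
  have "norm (w z *\<^sub>R (f z - c)) \<le> ?g z" for z
    using B[of z] supp[of z] B0 by (auto simp: indicator_def intro!: mult_right_mono)
  moreover have "(\<lambda>z. w z *\<^sub>R (f z - c)) \<in> borel_measurable lebesgue"
    using L1_loc_measurable[OF f] measurable_completion[of w lborel borel] w by auto
  ultimately show i: "integrable lebesgue (\<lambda>z. w z *\<^sub>R (f z - c))"
    by (intro Bochner_Integration.integrable_bound[OF ig]) (auto intro!: AE_I2 order_trans[OF _ abs_ge_self])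
  have "cmod (LINT z|lebesgue. w z *\<^sub>R (f z - c)) \<le> (LINT z|lebesgue. ?g z)"
    using i ig integrable_norm[OF i] \<open>\<And>z. norm (w z *\<^sub>R (f z - c)) \<le> ?g z\<close>
    by (intro order_trans[OF integral_norm_bound] Bochner_Integration.integral_mono) auto
  then show "cmod (LINT z|lebesgue. w z *\<^sub>R (f z - c)) \<le> B * (LINT z:cube a l|lebesgue. cmod (f z - c))"
    by (simp add: set_lebesgue_integral_def)
qed

section \<open>The tent kernel and its mass\<close>

text \<open>A cone of height and radius \<open>t\<close>. Left unnormalised, it has slope 1 at every
  scale, so moving the centre changes it by at most the displacement.\<close>

definition tent :: "real \<Rightarrow> real ^ 'n \<Rightarrow> real ^ 'n \<Rightarrow> real" where
  "tent t x y = max 0 (t - norm (y - x))"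

text \<open>The type argument carries the dimension, which \<open>t\<close> alone does not
  determine.\<close>

definition tent_mass :: "('n :: finite) itself \<Rightarrow> real \<Rightarrow> real" where
  "tent_mass _ t = (LINT y|lebesgue. tent t (0 :: real ^ 'n) y)"

definition mollify :: "(real ^ 'n \<Rightarrow> complex) \<Rightarrow> real \<Rightarrow> real ^ 'n \<Rightarrow> complex" where
  "mollify f t x = (LINT y|lebesgue. tent t x y *\<^sub>R f y) /\<^sub>R tent_mass TYPE('n) t"

lemma tent_measurable [measurable]: "tent t x \<in> borel_measurable borel"
  unfolding tent_def by measurable

lemma tent_bounds: "0 \<le> tent t x y" "0 \<le> t \<Longrightarrow> \<bar>tent t x y\<bar> \<le> t"
  by (auto simp: tent_def)

lemma tent_support: "cball x t \<subseteq> S \<Longrightarrow> y \<notin> S \<Longrightarrow> tent t x y = 0"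
  by (auto simp: tent_def dist_norm norm_minus_commute subset_eq max_def)

lemma tent_lipschitz: "\<bar>tent t x z - tent t y z\<bar> \<le> norm (x - y)"
proof -
  have "\<bar>norm (z - x) - norm (z - y)\<bar> \<le> norm (x - y)"
    using norm_triangle_ineq3[of "z - x" "z - y"] by (simp add: norm_minus_commute)
  then show ?thesis unfolding tent_def by linarith
qed

lemma centred_cube: "cball (x :: real ^ 'n) t \<subseteq> cube (\<chi> i. x $ i - t) (2 * t)"
  by (rule cball_subset_cube) auto

lemma L1_loc_const: "(\<lambda>x. c) \<in> L1_loc"
  by (auto simp: L1_loc_def set_integrable_def lmeasurable_compact simp flip: lmeasurable_iff_integrable)

lemma tent_integrable:
  assumes "f \<in> L1_loc" "0 < t"
  shows "integrable lebesgue (\<lambda>y. tent t x y *\<^sub>R (f y - c))"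
  using assms tent_support[OF centred_cube]
  by (intro weighted_integral_bound[where B=t and l="2*t" and a="\<chi> i. x $ i - t"])
    (auto intro: tent_bounds(2) simp del: abs_le_iff)

lemma tent_integrable_real:
  assumes "0 < t" shows "integrable lebesgue (tent t x)"
proof -
  \<comment> \<open>The tent is the real part of itself times the constant function 1, so the
    complex case applies.\<close>
  have "integrable lebesgue (\<lambda>y. Re (tent t x y *\<^sub>R (1 - 0)))"
    by (rule integrable_Re) (rule tent_integrable[OF L1_loc_const assms])
  then show ?thesis by simp
qed

lemma integral_tent:
  fixes x :: "real ^ 'n"
  shows "(LINT y|lebesgue. tent t x y) = tent_mass TYPE('n) t"
proof -
  \<comment> \<open>Translation invariance is applied to \<open>lborel\<close>; since the tent is
    Borel, its integral against the completion is the same.\<close>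
  have "(LINT y|lborel. tent t x y) = (LINT y|distr lborel borel ((+) x). tent t x y)"
    by (simp add: lborel_distr_plus)
  also have "\<dots> = (LINT y|lborel. tent t x (x + y))"
    by (rule integral_distr) auto
  also have "\<dots> = (LINT y|lborel. tent t (0 :: real ^ 'n) y)" by (simp add: tent_def)
  finally show ?thesis
    by (simp add: tent_mass_def integral_completion)
qed

text \<open>The cube of side \<open>t / CARD('n)\<close> centred at 0 lies in the ball of radius
  \<open>t / 2\<close>, because the norm is at most the sum of the coordinates in modulus. On that
  ball the tent is at least \<open>t / 2\<close>.\<close>

lemma tent_mass_ge:
  assumes t: "0 < t"
  shows "t / 2 * (t / CARD('n :: finite)) ^ CARD('n) \<le> tent_mass TYPE('n) t"
proof -
  define s where "s = t / CARD('n)"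
  have s: "0 < s" using t by (simp add: s_def)
  define a :: "real ^ 'n" where "a = (\<chi> i. - (s / 2))"
  have "norm y \<le> t / 2" if "y \<in> cube a s" for y
  proof -
    have "norm y \<le> (\<Sum>i\<in>UNIV. \<bar>y $ i\<bar>)" by (rule norm_le_l1_cart)
    also have "\<dots> \<le> (\<Sum>i\<in>(UNIV :: 'n set). s / 2)"
      using that by (intro sum_mono) (simp add: mem_cube a_def abs_le_iff, smt (verit) field_sum_of_halves)
    finally show ?thesis by (simp add: s_def)
  qed
  then have "indicator (cube a s) y *\<^sub>R (t / 2) \<le> tent t 0 y" for y
    using tent_bounds(1)[of t 0 y] by (auto simp: indicator_def tent_def) (smt (verit) field_sum_of_halves)
  moreover have "integrable lebesgue (\<lambda>y. indicator (cube a s) y *\<^sub>R (t / 2))"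
    using cube_facts(4)[OF s] by (intro integrable_scaleR_left) (simp add: lmeasurable_iff_integrable)
  ultimately have "(LINT y|lebesgue. indicator (cube a s) y *\<^sub>R (t / 2)) \<le> (LINT y|lebesgue. tent t (0 :: real ^ 'n) y)"
    by (intro Bochner_Integration.integral_mono tent_integrable_real t) auto
  then show ?thesis
    using s cube_facts(2)[OF s, of a] by (simp add: measure_cube tent_mass_def s_def mult.commute)
qed

lemma tent_mass_pos: "0 < t \<Longrightarrow> 0 < tent_mass TYPE('n :: finite) t"
  by (rule less_le_trans[OF _ tent_mass_ge]) simp

lemma mollify_minus_const:
  fixes f :: "real ^ 'n \<Rightarrow> complex"
  assumes f: "f \<in> L1_loc" and t: "0 < t"
  shows "mollify f t x - c = (LINT y|lebesgue. tent t x y *\<^sub>R (f y - c)) /\<^sub>R tent_mass TYPE('n) t"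
proof -
  have i: "integrable lebesgue (\<lambda>y. tent t x y *\<^sub>R g y)" if "g \<in> L1_loc" for g :: "real ^ 'n \<Rightarrow> complex"
    using tent_integrable[OF that t, of x 0] by simp
  have "(LINT y|lebesgue. tent t x y *\<^sub>R c) = tent_mass TYPE('n) t *\<^sub>R c"
    using integral_scaleR_left[OF tent_integrable_real[OF t, of x], of c] by (simp add: integral_tent)
  then show ?thesis
    using i[OF f] i[OF L1_loc_const[of c]] tent_mass_pos[OF t, where 'n = 'n]
    by (simp add: mollify_def scaleR_diff_right)
qed

lemma set_integral_cube_le:
  fixes h :: "real ^ 'n \<Rightarrow> real"
  assumes "0 < l" "set_integrable lebesgue (cube a l) h" "\<And>x. x \<in> cube a l \<Longrightarrow> h x \<le> B"
  shows "(LINT x:cube a l|lebesgue. h x) \<le> B * l ^ CARD('n)"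
proof -
  have em: "emeasure lebesgue (cube a l) \<noteq> \<infinity>"
    unfolding infinity_ennreal_def by (rule fmeasurableD2[OF cube_facts(4)[OF assms(1)]])
  have "set_integrable lebesgue (cube a l) (\<lambda>x. B)"
    using cube_facts(4)[OF assms(1), of a]
    unfolding set_integrable_def by (intro integrable_scaleR_left) (simp add: lmeasurable_iff_integrable)
  then have "(LINT x:cube a l|lebesgue. h x) \<le> (LINT x:cube a l|lebesgue. B)"
    using assms by (intro set_integral_mono)
  also have "\<dots> = B * l ^ CARD('n)"
    using set_integral_const[OF cube_facts(2)[OF assms(1)] em, of B] assms(1) by (simp add: measure_cube)
  finally show ?thesis .
qed

text \<open>This is \<open>t * (8 * t) ^ CARD('n)\<close> divided by the lower bound for the tent
  mass. The factor 8 leaves room for the cubes of side \<open>3 * t\<close> and \<open>4 * t\<close>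
  used below.\<close>

definition mollify_const :: "('n :: finite) itself \<Rightarrow> real" where
  "mollify_const _ = 2 * (8 * CARD('n)) ^ CARD('n)"

lemma mollify_const_pos: "0 < mollify_const TYPE('n :: finite)"
  by (simp add: mollify_const_def)

lemma tent_mass_ratio:
  assumes t: "0 < t" and l: "0 \<le> l" "l \<le> 8 * t"
  shows "t * l ^ CARD('n :: finite) / tent_mass TYPE('n) t \<le> mollify_const TYPE('n)"
proof -
  have "t * l ^ CARD('n) \<le> t * (8 * t) ^ CARD('n)"
    using assms by (intro mult_left_mono power_mono) auto
  also have "\<dots> = mollify_const TYPE('n) * (t / 2 * (t / CARD('n)) ^ CARD('n))"
    by (simp add: mollify_const_def power_mult_distrib power_divide)
  also have "\<dots> \<le> mollify_const TYPE('n) * tent_mass TYPE('n) t"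
    using mollify_const_pos[where 'n='n] tent_mass_ge[OF t, where 'n='n] by (intro mult_left_mono) auto
  finally show ?thesis using tent_mass_pos[OF t, where 'n='n] by (simp add: field_simps)
qed

section \<open>Pointwise estimates for mollifications\<close>

text \<open>The normalised tent is at most \<open>mollify_const\<close> divided by the volume of the
  cube, so averaging \<open>f\<close> minus its mean against it costs at most that multiple of the
  oscillation.\<close>

lemma mollify_near_mean:
  fixes f :: "real ^ 'n \<Rightarrow> complex"
  assumes f: "f \<in> L1_loc" and t: "0 < t" and l: "0 < l" "l \<le> 8 * t" and x: "cball x t \<subseteq> cube a l"
  shows "cmod (mollify f t x - mean f (cube a l)) \<le> mollify_const TYPE('n) * mean_osc f (cube a l)"
proof -
  let ?c = "mean f (cube a l)" and ?m = "tent_mass TYPE('n) t"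
  have m: "0 < ?m" by (rule tent_mass_pos[OF t])
  have "cmod (LINT y|lebesgue. tent t x y *\<^sub>R (f y - ?c)) \<le> t * (LINT z:cube a l|lebesgue. cmod (f z - ?c))"
    using tent_support[OF x] t by (intro weighted_integral_bound(2) f l) (auto intro: tent_bounds(2) simp del: abs_le_iff)
  then have "cmod (mollify f t x - ?c) \<le> (t * l ^ CARD('n) / ?m) * mean_osc f (cube a l)"
    using m unfolding mollify_minus_const[OF f t] integral_osc[OF l(1)]
    by (simp add: field_simps)
  also have "\<dots> \<le> mollify_const TYPE('n) * mean_osc f (cube a l)"
    using tent_mass_ratio[OF t, of l] l mean_osc_nonneg by (intro mult_right_mono) auto
  finally show ?thesis .
qed

text \<open>Both tents have the same mass, so the mean cancels. The difference of the tents is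
  bounded by \<open>norm (x - y)\<close> instead of \<open>t\<close>, which gains the factor
  \<open>norm (x - y) / t\<close>.\<close>

lemma mollify_increment:
  fixes f :: "real ^ 'n \<Rightarrow> complex"
  assumes f: "f \<in> L1_loc" and t: "0 < t" and l: "0 < l" "l \<le> 8 * t"
    and x: "cball x t \<subseteq> cube a l" and y: "cball y t \<subseteq> cube a l"
  shows "cmod (mollify f t x - mollify f t y)
    \<le> norm (x - y) / t * (mollify_const TYPE('n) * mean_osc f (cube a l))"
proof -
  let ?c = "mean f (cube a l)" and ?m = "tent_mass TYPE('n) t"
  let ?w = "\<lambda>z. tent t x z - tent t y z"
  have m: "0 < ?m" by (rule tent_mass_pos[OF t])
  have "mollify f t x - mollify f t y = (mollify f t x - ?c) - (mollify f t y - ?c)" by simp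
  also have "\<dots> = (LINT z|lebesgue. ?w z *\<^sub>R (f z - ?c)) /\<^sub>R ?m"
    using tent_integrable[OF f t, of x ?c] tent_integrable[OF f t, of y ?c]
    unfolding mollify_minus_const[OF f t] by (simp add: scaleR_diff_left flip: scaleR_diff_right)
  finally have eq: "mollify f t x - mollify f t y = \<dots>" .
  have "cmod (LINT z|lebesgue. ?w z *\<^sub>R (f z - ?c))
      \<le> norm (x - y) * (LINT z:cube a l|lebesgue. cmod (f z - ?c))"
    using tent_support[OF x] tent_support[OF y]
    by (intro weighted_integral_bound(2) f l) (auto intro: tent_lipschitz simp del: abs_le_iff)
  then have "cmod (mollify f t x - mollify f t y)
      \<le> norm (x - y) / t * ((t * l ^ CARD('n) / ?m) * mean_osc f (cube a l))"
    using m t unfolding eq integral_osc[OF l(1)] by (simp add: field_simps)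
  also have "\<dots> \<le> norm (x - y) / t * (mollify_const TYPE('n) * mean_osc f (cube a l))"
    using tent_mass_ratio[OF t, of l] l t mean_osc_nonneg
    by (intro mult_left_mono mult_right_mono) auto
  finally show ?thesis .
qed

lemma cball_subset_centred_cube:
  fixes x y :: "real ^ 'n"
  assumes "norm (x - y) + t \<le> s"
  shows "cball y t \<subseteq> cube (\<chi> i. x $ i - s) (2 * s)"
proof (rule cball_subset_cube)
  fix i
  have "\<bar>x $ i - y $ i\<bar> + t \<le> s" using component_le_norm_cart[of "x - y" i] assms by simp
  then show "(\<chi> i. x $ i - s) $ i + t \<le> y $ i" "y $ i + t \<le> (\<chi> i. x $ i - s) $ i + 2 * s" by auto
qed

lemma mollify_continuous:
  fixes f :: "real ^ 'n \<Rightarrow> complex"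
  assumes f: "f \<in> L1_loc" and t: "0 < t"
  shows "continuous_on UNIV (mollify f t)"
proof (intro continuous_at_imp_continuous_on ballI)
  fix x
  \<comment> \<open>This cube is centred at \<open>x\<close> and contains the ball of radius
    \<open>t\<close> about every point within \<open>t\<close> of \<open>x\<close>, so one constant
    serves all nearby \<open>y\<close>.\<close>
  define K where "K = mollify_const TYPE('n) * mean_osc f (cube (\<chi> i. x $ i - 2 * t) (4 * t))"
  have bound: "cmod (mollify f t y - mollify f t x) \<le> norm (y - x) / t * K" if "dist y x < t" for y
    unfolding K_def using that t cball_subset_centred_cube[of x y t "2 * t"] cball_subset_centred_cube[of x x t "2 * t"]
    by (intro mollify_increment f) (auto simp: dist_norm norm_minus_commute)
  have ev: "\<forall>\<^sub>F y in at x. dist y x < t"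
    using t by (auto simp: eventually_at)
  have "((\<lambda>y. mollify f t y - mollify f t x) \<longlongrightarrow> 0) (at x)"
  proof (rule Lim_null_comparison)
    show "\<forall>\<^sub>F y in at x. cmod (mollify f t y - mollify f t x) \<le> norm (y - x) / t * K"
      using ev by eventually_elim (rule bound)
    have "((\<lambda>y. norm (y - x) / t * K) \<longlongrightarrow> norm (x - x) / t * K) (at x)"
      using t by (intro tendsto_intros) auto
    then show "((\<lambda>y. norm (y - x) / t * K) \<longlongrightarrow> 0) (at x)" by simp
  qed
  then show "isCont (mollify f t) x" unfolding isCont_def by (simp add: LIM_zero_iff)
qed

lemma continuous_imp_L1_loc:
  fixes f :: "real ^ 'n \<Rightarrow> complex"
  assumes "continuous_on UNIV f" shows "f \<in> L1_loc"
  unfolding L1_loc_def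
proof safe
  fix K :: "(real ^ 'n) set" assume K: "compact K"
  then obtain a where "K \<subseteq> cbox (- a) a"
    using bounded_subset_cbox_symmetric compact_imp_bounded by blast
  moreover have "f absolutely_integrable_on cbox (- a) a"
    using assms by (intro absolutely_integrable_continuous) (rule continuous_on_subset, auto)
  ultimately show "f absolutely_integrable_on K"
    using K by (auto intro: set_integrable_subset simp: lmeasurable_compact fmeasurableD)
qed

section \<open>Subdivision of cubes and the approximation error\<close>

text \<open>The set \<open>S\<close> records the coordinates in which the upper half is taken. The
  closed subcubes overlap on faces; as \<open>h\<close> is nonnegative, covering suffices for an
  inequality.\<close>

lemma integral_cube_halves:
  fixes h :: "real ^ 'n \<Rightarrow> real"
  assumes l: "0 < l" and int: "\<And>a l. 0 < l \<Longrightarrow> set_integrable lebesgue (cube a l) h" and nn: "\<And>x. 0 \<le> h x"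
  shows "(LINT x:cube a l|lebesgue. h x) \<le>
    (\<Sum>S\<in>UNIV. LINT x:cube (\<chi> i. if i \<in> S then a $ i + l / 2 else a $ i) (l / 2)|lebesgue. h x)"
proof -
  let ?q = "\<lambda>S. cube (\<chi> i. if i \<in> S then a $ i + l / 2 else a $ i) (l / 2)"
  have i: "integrable lebesgue (\<lambda>x. indicator (?q S) x *\<^sub>R h x)" for S
    using int[of "l / 2"] l unfolding set_integrable_def by simp
  have "indicator (cube a l) x *\<^sub>R h x \<le> (\<Sum>S\<in>UNIV. indicator (?q S) x *\<^sub>R h x)" for x
  proof (cases "x \<in> cube a l")
    case True
    define S where "S = {i. a $ i + l / 2 < x $ i}"
    have "x \<in> ?q S" using True by (auto simp: mem_cube S_def add.commute)
    then have "indicator (cube a l) x *\<^sub>R h x \<le> indicator (?q S) x *\<^sub>R h x"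
      using nn by (simp add: indicator_def)
    also have "\<dots> \<le> (\<Sum>S\<in>UNIV. indicator (?q S) x *\<^sub>R h x)"
      by (rule member_le_sum) (auto simp: nn)
    finally show ?thesis .
  next
    case False
    then show ?thesis by (auto intro!: sum_nonneg simp: nn)
  qed
  then have "(LINT x|lebesgue. indicator (cube a l) x *\<^sub>R h x) \<le> (LINT x|lebesgue. (\<Sum>S\<in>UNIV. indicator (?q S) x *\<^sub>R h x))"
    using int[OF l, of a] i unfolding set_integrable_def
    by (intro Bochner_Integration.integral_mono Bochner_Integration.integrable_sum) auto
  also have "\<dots> = (\<Sum>S\<in>UNIV. LINT x|lebesgue. indicator (?q S) x *\<^sub>R h x)"
    using i by (intro Bochner_Integration.integral_sum) auto
  finally show ?thesis unfolding set_lebesgue_integral_def .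
qed

text \<open>Halving repeatedly brings the side into the range from \<open>s\<close> to
  \<open>2 * s\<close>. Each halving gives \<open>2 ^ CARD('n)\<close> cubes of
  \<open>1 / 2 ^ CARD('n)\<close> the volume, so \<open>B\<close> is unchanged.\<close>

lemma integral_cube_large:
  fixes h :: "real ^ 'n \<Rightarrow> real"
  assumes int: "\<And>a l. 0 < l \<Longrightarrow> set_integrable lebesgue (cube a l) h" and nn: "\<And>x. 0 \<le> h x"
    and s: "0 < s" and base: "\<And>a l. s \<le> l \<Longrightarrow> l \<le> 2 * s \<Longrightarrow> (LINT x:cube a l|lebesgue. h x) \<le> B * l ^ CARD('n)"
    and l: "s \<le> l"
  shows "(LINT x:cube a l|lebesgue. h x) \<le> B * l ^ CARD('n)"
proof -
  obtain k where k: "l / s < 2 ^ k" using real_arch_pow[of 2 "l / s"] by auto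
  have "(LINT x:cube a l|lebesgue. h x) \<le> B * l ^ CARD('n)" if "s \<le> l" "l \<le> 2 ^ k * s" for a l
    using that
  proof (induction k arbitrary: a l)
    case 0
    then show ?case using base[of l a] s by simp
  next
    case (Suc k)
    show ?case
    proof (cases "l \<le> 2 * s")
      case True
      then show ?thesis using Suc base by simp
    next
      case False
      have "(LINT x:cube a l|lebesgue. h x) \<le>
        (\<Sum>S\<in>UNIV. LINT x:cube (\<chi> i. if i \<in> S then a $ i + l / 2 else a $ i) (l / 2)|lebesgue. h x)"
        using False s by (intro integral_cube_halves int nn) auto
      also have "\<dots> \<le> (\<Sum>S\<in>(UNIV :: 'n set set). B * (l / 2) ^ CARD('n))"
        using False Suc.prems by (intro sum_mono Suc.IH) auto
      also have "\<dots> = B * l ^ CARD('n)"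
        using card_Pow[of "UNIV :: 'n set"] by (simp add: power_divide)
      finally show ?thesis .
    qed
  qed
  then show ?thesis using l k s by (simp add: field_simps less_imp_le)
qed

text \<open>For sides up to \<open>t\<close> the two functions are treated separately:
  \<open>f\<close> oscillates by at most \<open>\<delta>\<close>, and its mollification stays near a
  constant. For larger sides the mean modulus of the difference is bounded at sides between
  \<open>t / 2\<close> and \<open>t\<close> and then carried up by subdivision.\<close>

lemma mean_osc_diff_mollify:
  fixes f :: "real ^ 'n \<Rightarrow> complex"
  assumes f: "f \<in> L1_loc" and t: "0 < t" and l: "0 < l"
    and \<delta>: "\<And>a l. 0 < l \<Longrightarrow> l \<le> 3 * t \<Longrightarrow> mean_osc f (cube a l) \<le> \<delta>"
  shows "mean_osc (\<lambda>x. f x - mollify f t x) (cube a l)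
    \<le> 2 * (6 ^ CARD('n) + mollify_const TYPE('n)) * \<delta>"
proof -
  let ?n = "CARD('n)" and ?A = "mollify_const TYPE('n)" and ?g = "mollify f t"
  \<comment> \<open>Contains the \<open>t\<close>-neighbourhood of every cube with corner
    \<open>a\<close> and side at most \<open>t\<close>; its own side is the largest for which the
    hypothesis on \<open>\<delta>\<close> is available.\<close>
  let ?R = "\<lambda>a :: real ^ 'n. cube (\<chi> i. a $ i - t) (3 * t)"
  have gL: "?g \<in> L1_loc" by (intro continuous_imp_L1_loc mollify_continuous f t)
  have hL: "(\<lambda>x. f x - ?g x) \<in> L1_loc" by (rule L1_loc_diff[OF f gL])
  have \<delta>0: "0 \<le> \<delta>"
    using order_trans[OF mean_osc_nonneg \<delta>[of t a]] t by simp
  have near: "cmod (?g x - mean f (?R a)) \<le> ?A * \<delta>" if "x \<in> cube a l" "l \<le> t" for x a l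
  proof -
    have "cball x t \<subseteq> ?R a"
      using that by (intro cball_subset_cube) (simp_all add: mem_cube, smt (verit))
    then have "cmod (?g x - mean f (?R a)) \<le> ?A * mean_osc f (?R a)"
      using t by (intro mollify_near_mean f) auto
    also have "\<dots> \<le> ?A * \<delta>"
      using t mollify_const_pos[where 'n='n] by (intro mult_left_mono \<delta>) auto
    finally show ?thesis .
  qed
  show ?thesis
  proof (cases "l \<le> t")
    case True
    have "mean_osc ?g (cube a l) \<le> 2 * (LINT x:cube a l|lebesgue. cmod (?g x - mean f (?R a))) / l ^ ?n"
      by (rule mean_osc_le_integral[OF gL l])
    also have "\<dots> \<le> 2 * (?A * \<delta> * l ^ ?n) / l ^ ?n"
      using l near True by (intro divide_right_mono mult_left_mono set_integral_cube_le osc_integrable gL) auto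
    also have "\<dots> = 2 * ?A * \<delta>" using l by simp
    finally have "mean_osc (\<lambda>x. f x - ?g x) (cube a l) \<le> \<delta> + 2 * ?A * \<delta>"
      using mean_osc_diff[OF f gL l, of a] \<delta>[OF l, of a] True t by linarith
    \<comment> \<open>Absorbs the oscillation of \<open>f\<close> into the constant shared by both
      cases.\<close>
    moreover have "1 * \<delta> \<le> 2 * 6 ^ ?n * \<delta>"
      using one_le_power[of "6 :: real" ?n] by (intro mult_right_mono \<delta>0) linarith
    ultimately show ?thesis by (simp add: algebra_simps)
  next
    case False
    have "(LINT x:cube a l|lebesgue. cmod (f x - ?g x)) \<le> (6 ^ ?n + ?A) * \<delta> * l ^ ?n"
    \<comment> \<open>Starting at \<open>t / 2\<close> keeps the base sides at most
      \<open>t\<close>, where \<open>near\<close> applies.\<close>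
    proof (rule integral_cube_large[where s = "t / 2"])
      show "set_integrable lebesgue (cube a l) (\<lambda>x. cmod (f x - ?g x))" if "0 < l" for a l
        using osc_integrable[OF hL that, of a 0] by simp
    next
      fix a :: "real ^ 'n" and l assume l: "t / 2 \<le> l" "l \<le> 2 * (t / 2)"
      have l0: "0 < l" using l t by simp
      let ?c = "mean f (?R a)"
      have sub: "cube a l \<subseteq> ?R a"
      proof
        fix x assume "x \<in> cube a l"
        then have "a $ i \<le> x $ i \<and> x $ i \<le> a $ i + l" for i by (simp add: mem_cube)
        then have "a $ i - t \<le> x $ i \<and> x $ i \<le> a $ i - t + 3 * t" for i using l t by (smt (verit) field_sum_of_halves)
        then show "x \<in> ?R a" unfolding mem_cube by simp
      qed
      have "(LINT x:cube a l|lebesgue. cmod (f x - ?g x)) \<le>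
          (LINT x:cube a l|lebesgue. cmod (f x - ?c) + cmod (?g x - ?c))"
      proof (rule set_integral_mono)
        show "set_integrable lebesgue (cube a l) (\<lambda>x. cmod (f x - ?g x))"
          using osc_integrable[OF hL l0, of a 0] by simp
        fix x
        have "f x - ?g x = (f x - ?c) - (?g x - ?c)" by simp
        then show "cmod (f x - ?g x) \<le> cmod (f x - ?c) + cmod (?g x - ?c)"
          by (metis norm_triangle_ineq4)
      qed (intro set_integral_add osc_integrable f gL l0)
      also have "\<dots> = (LINT x:cube a l|lebesgue. cmod (f x - ?c)) + (LINT x:cube a l|lebesgue. cmod (?g x - ?c))"
        by (intro set_integral_add osc_integrable f gL l0)
      also have "(LINT x:cube a l|lebesgue. cmod (?g x - ?c)) \<le> ?A * \<delta> * l ^ ?n"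
        using near l by (intro set_integral_cube_le osc_integrable gL l0) auto
      also have "(LINT x:cube a l|lebesgue. cmod (f x - ?c)) \<le> (LINT x:?R a|lebesgue. cmod (f x - ?c))"
        using sub t osc_integrable[OF f, of "3 * t" "\<chi> i. a $ i - t" ?c] osc_integrable[OF f l0, of a ?c]
        unfolding set_lebesgue_integral_def set_integrable_def
        by (intro Bochner_Integration.integral_mono) (auto simp: indicator_def)
      also have "\<dots> = (3 * t) ^ ?n * mean_osc f (?R a)"
        using t by (intro integral_osc) auto
      \<comment> \<open>From \<open>t / 2 \<le> l\<close> comes \<open>3 * t \<le> 6 * l\<close>,
        the origin of the 6 in the constant.\<close>
      also have "\<dots> \<le> (6 * l) ^ ?n * \<delta>"
        using l t by (intro mult_mono[OF power_mono \<delta>] mean_osc_nonneg) auto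
      finally show "(LINT x:cube a l|lebesgue. cmod (f x - ?g x)) \<le> (6 ^ ?n + ?A) * \<delta> * l ^ ?n"
        by (simp add: algebra_simps power_mult_distrib)
    qed (use t False in auto)
    then have "2 * (LINT x:cube a l|lebesgue. cmod (f x - ?g x - 0)) / l ^ ?n \<le> 2 * (6 ^ ?n + ?A) * \<delta>"
      using l by (simp add: field_simps)
    then show ?thesis using mean_osc_le_integral[OF hL l, of a 0] by linarith
  qed
qed

section \<open>Growth and Hoelder continuity of mollifications\<close>

text \<open>One cube of side \<open>4 * t\<close> centred at \<open>x\<close> serves both claims: it
  contains the ball of radius \<open>2 * t\<close> about \<open>x\<close> and the balls of radius
  \<open>t\<close> about points within \<open>t\<close> of \<open>x\<close>.\<close>

lemma mollify_step:
  fixes f :: "real ^ 'n \<Rightarrow> complex"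
  assumes f: "f \<in> BMO" and t: "0 < t"
  shows "norm (x - y) \<le> t \<Longrightarrow>
      cmod (mollify f t x - mollify f t y) \<le> norm (x - y) / t * (mollify_const TYPE('n) * BMO_norm f)"
    and "cmod (mollify f t x - mollify f (2 * t) x) \<le> 2 * (mollify_const TYPE('n) * BMO_norm f)"
proof -
  let ?A = "mollify_const TYPE('n)" and ?R = "cube (\<chi> i. x $ i - 2 * t) (4 * t)"
  have L: "f \<in> L1_loc" using f by (simp add: BMO_def)
  have osc: "?A * mean_osc f ?R \<le> ?A * BMO_norm f"
    using t mollify_const_pos[where 'n='n] by (intro mult_left_mono mean_osc_le_norm f) auto
  have sub: "cball y s \<subseteq> ?R" if "norm (x - y) + s \<le> 2 * t" for y s
    using cball_subset_centred_cube[OF that] by simp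
  show "cmod (mollify f t x - mollify f t y) \<le> norm (x - y) / t * (?A * BMO_norm f)"
    if "norm (x - y) \<le> t"
  proof -
    have "cmod (mollify f t x - mollify f t y) \<le> norm (x - y) / t * (?A * mean_osc f ?R)"
      using t that by (intro mollify_increment L sub) auto
    also have "\<dots> \<le> norm (x - y) / t * (?A * BMO_norm f)"
      using t by (intro mult_left_mono osc) auto
    finally show ?thesis .
  qed
  have "cmod (mollify f t x - mean f ?R) \<le> ?A * mean_osc f ?R"
    using t by (intro mollify_near_mean L sub) auto
  moreover have "cmod (mollify f (2 * t) x - mean f ?R) \<le> ?A * mean_osc f ?R"
    using t by (intro mollify_near_mean L sub) auto
  moreover have "mollify f t x - mollify f (2 * t) x
      = (mollify f t x - mean f ?R) - (mollify f (2 * t) x - mean f ?R)" by simp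
  then have "cmod (mollify f t x - mollify f (2 * t) x)
      \<le> cmod (mollify f t x - mean f ?R) + cmod (mollify f (2 * t) x - mean f ?R)"
    by (metis norm_triangle_ineq4)
  ultimately show "cmod (mollify f t x - mollify f (2 * t) x) \<le> 2 * (?A * BMO_norm f)"
    using osc by linarith
qed

text \<open>After \<open>k\<close> doublings the scale reaches the distance of the points, and the
  increment there costs one unit. Each doubling costs two units at \<open>x\<close> and two at
  \<open>y\<close>.\<close>

lemma mollify_dyadic_growth:
  fixes f :: "real ^ 'n \<Rightarrow> complex"
  assumes f: "f \<in> BMO" and t: "0 < t" and xy: "norm (x - y) \<le> 2 ^ k * t"
  shows "cmod (mollify f t x - mollify f t y) \<le> (4 * real k + 1) * (mollify_const TYPE('n) * BMO_norm f)"
  using t xy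
proof (induction k arbitrary: t)
  case 0
  have "norm (x - y) / t * (mollify_const TYPE('n) * BMO_norm f) \<le> 1 * (mollify_const TYPE('n) * BMO_norm f)"
    using 0 BMO_norm_nonneg[OF f] mollify_const_pos[where 'n='n] by (intro mult_right_mono) auto
  then show ?case using mollify_step(1)[OF f 0(1), of x y] 0 by simp
next
  case (Suc k)
  let ?M = "mollify_const TYPE('n) * BMO_norm f"
  have "cmod (mollify f (2 * t) x - mollify f (2 * t) y) \<le> (4 * real k + 1) * ?M"
    using Suc.prems by (intro Suc.IH) auto
  moreover have "mollify f t x - mollify f t y = (mollify f t x - mollify f (2 * t) x)
      + (mollify f (2 * t) x - mollify f (2 * t) y) - (mollify f t y - mollify f (2 * t) y)"
    by simp
  then have "cmod (mollify f t x - mollify f t y) \<le> cmod (mollify f t x - mollify f (2 * t) x)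
      + cmod (mollify f (2 * t) x - mollify f (2 * t) y) + cmod (mollify f t y - mollify f (2 * t) y)"
    by (simp only:) (intro order_trans[OF norm_triangle_ineq4] add_right_mono norm_triangle_ineq)
  ultimately have "cmod (mollify f t x - mollify f t y) \<le> 2 * ?M + (4 * real k + 1) * ?M + 2 * ?M"
    using mollify_step(2)[OF f Suc.prems(1), of x] mollify_step(2)[OF f Suc.prems(1), of y] by linarith
  then show ?case by (simp add: algebra_simps)
qed

lemma Holder_homI:
  assumes "\<And>x y. x \<noteq> y \<Longrightarrow> cmod (f x - f y) \<le> C * norm (x - y) powr \<eta>"
  shows "f \<in> Holder_hom \<eta>"
  unfolding Holder_hom_def using assms
  by (auto intro!: bdd_aboveI[where M = C] simp: divide_le_eq)

lemma Holder_homE: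
  fixes f :: "real ^ 'n \<Rightarrow> complex"
  assumes "f \<in> Holder_hom \<eta>"
  obtains C where "0 \<le> C" "\<And>x y. cmod (f x - f y) \<le> C * norm (x - y) powr \<eta>"
proof -
  obtain M where M: "\<And>x y. x \<noteq> y \<Longrightarrow> cmod (f x - f y) / norm (x - y) powr \<eta> \<le> M"
    using assms unfolding Holder_hom_def bdd_above_def by blast
  have "cmod (f x - f y) \<le> max 0 M * norm (x - y) powr \<eta>" for x y
  proof (cases "x = y")
    case False
    then have "cmod (f x - f y) / norm (x - y) powr \<eta> \<le> max 0 M" using M[of x y] by simp
    then show ?thesis using False by (simp add: divide_le_eq)
  qed simp
  then show ?thesis using that[of "max 0 M"] by simp
qed

text \<open>Gives the measurability that \<open>Holder_hom\<close> does not ask for.\<close>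

lemma Holder_continuous:
  fixes f :: "real ^ 'n \<Rightarrow> complex"
  assumes "f \<in> Holder_hom \<eta>" and \<eta>: "0 < \<eta>"
  shows "continuous_on UNIV f"
proof (intro continuous_at_imp_continuous_on ballI)
  fix x
  obtain C where C: "\<And>x y. cmod (f x - f y) \<le> C * norm (x - y) powr \<eta>"
    using Holder_homE[OF assms(1)] by blast
  have "((\<lambda>y. f y - f x) \<longlongrightarrow> 0) (at x)"
  proof (rule Lim_null_comparison)
    show "\<forall>\<^sub>F y in at x. cmod (f y - f x) \<le> C * norm (y - x) powr \<eta>" using C by simp
    have "((\<lambda>y. norm (y - x) powr \<eta>) \<longlongrightarrow> norm (x - x) powr \<eta>) (at x)"
      using \<eta> by (intro tendsto_powr' tendsto_intros) auto
    then show "((\<lambda>y. C * norm (y - x) powr \<eta>) \<longlongrightarrow> 0) (at x)"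
      by (intro tendsto_mult_right_zero) simp
  qed
  then show "isCont f x" unfolding isCont_def by (simp add: LIM_zero_iff)
qed

lemma mollify_Holder:
  fixes f :: "real ^ 'n \<Rightarrow> complex"
  assumes f: "f \<in> BMO" and t: "0 < t" and \<eta>: "0 < \<eta>" "\<eta> < 1"
  shows "mollify f t \<in> Holder_hom \<eta>"
proof (rule Holder_homI)
  define M where "M = mollify_const TYPE('n) * BMO_norm f"
  \<comment> \<open>For \<open>u > 1\<close> the dyadic bound is at most
    \<open>4 * log 2 u + 5\<close>. Here
    \<open>log 2 u \<le> u powr \<eta> / (\<eta> * ln 2)\<close> and
    \<open>1 \<le> u powr \<eta>\<close>, which gives the two summands.\<close>
  define K where "K = 5 + 4 / (\<eta> * ln 2)"
  have M0: "0 \<le> M" using BMO_norm_nonneg[OF f] mollify_const_pos[where 'n='n] by (simp add: M_def)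
  have K1: "1 \<le> K" using \<eta> by (simp add: K_def)
  fix x y :: "real ^ 'n" assume "x \<noteq> y"
  define u where "u = norm (x - y) / t"
  have u0: "0 < u" using \<open>x \<noteq> y\<close> t by (simp add: u_def)
  have "cmod (mollify f t x - mollify f t y) \<le> K * u powr \<eta> * M"
  proof (cases "u \<le> 1")
    case True
    have "cmod (mollify f t x - mollify f t y) \<le> u * M"
      using mollify_step(1)[OF f t, of x y] True t by (simp add: u_def M_def)
    also have "u \<le> u powr \<eta>" using powr_mono'[of \<eta> 1 u] \<eta> u0 True by simp
    also have "u powr \<eta> \<le> K * u powr \<eta>" using K1 by (simp add: mult_le_cancel_right1)
    finally show ?thesis using M0 by (simp add: mult_right_mono)
  next
    case False
    define k where "k = nat \<lceil>log 2 u\<rceil>"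
    have lg: "0 < log 2 u" using False by simp
    have k1: "log 2 u \<le> k" and k2: "k \<le> log 2 u + 1"
      using lg unfolding k_def by linarith+
    have "u \<le> 2 ^ k" using k1 u0 by (simp add: log_le_iff powr_realpow)
    then have "norm (x - y) \<le> 2 ^ k * t" using t by (simp add: u_def field_simps)
    then have "cmod (mollify f t x - mollify f t y) \<le> (4 * real k + 1) * M"
      unfolding M_def by (rule mollify_dyadic_growth[OF f t])
    moreover have "4 * real k + 1 \<le> K * u powr \<eta>"
    proof -
      \<comment> \<open>This is \<open>ln v \<le> v - 1\<close> at
        \<open>v = u powr \<eta>\<close>.\<close>
      have "\<eta> * ln u \<le> u powr \<eta>"
        using ln_le_minus_one[of "u powr \<eta>"] u0 by (simp add: ln_powr)
      then have "log 2 u \<le> u powr \<eta> / (\<eta> * ln 2)"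
        using \<eta> by (simp add: log_def field_simps)
      moreover have "1 \<le> u powr \<eta>" using False \<eta> by (intro ge_one_powr_ge_zero) auto
      ultimately have "4 * real k + 1 \<le> 5 * u powr \<eta> + 4 * (u powr \<eta> / (\<eta> * ln 2))" using k2 by linarith
      then show ?thesis by (simp add: K_def algebra_simps)
    qed
    ultimately show ?thesis using M0 by (meson mult_right_mono order_trans)
  qed
  then show "cmod (mollify f t x - mollify f t y) \<le> (K * M / t powr \<eta>) * norm (x - y) powr \<eta>"
    using t by (simp add: u_def powr_divide field_simps)
qed

section \<open>Vanishing mean oscillation\<close>

text \<open>Points of a cube of side \<open>l\<close> lie within \<open>CARD('n) * l\<close> of its
  corner, so the oscillation is of order \<open>l powr \<eta>\<close>. This yields the inclusion
  that density presupposes.\<close>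

lemma Holder_BMO_imp_VMO:
  fixes f :: "real ^ 'n \<Rightarrow> complex"
  assumes h: "f \<in> Holder_hom \<eta>" and b: "f \<in> BMO" and \<eta>: "0 < \<eta>"
  shows "f \<in> VMO"
proof -
  obtain C where C: "0 \<le> C" "\<And>x y. cmod (f x - f y) \<le> C * norm (x - y) powr \<eta>"
    using Holder_homE[OF h] by blast
  have L: "f \<in> L1_loc" using b by (simp add: BMO_def)
  have osc: "mean_osc f (cube a l) \<le> 2 * C * (real CARD('n) * l) powr \<eta>" if l: "0 < l" for a :: "real ^ 'n" and l :: real
  proof -
    have "cmod (f x - f a) \<le> C * (real CARD('n) * l) powr \<eta>" if x: "x \<in> cube a l" for x
    proof -
      have "norm (x - a) \<le> (\<Sum>i\<in>UNIV. \<bar>(x - a) $ i\<bar>)" by (rule norm_le_l1_cart)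
      also have "\<dots> \<le> (\<Sum>i\<in>(UNIV :: 'n set). l)"
      proof (rule sum_mono)
        fix i
        have "a $ i \<le> x $ i \<and> x $ i \<le> a $ i + l" using x by (simp add: mem_cube)
        then show "\<bar>(x - a) $ i\<bar> \<le> l" by simp
      qed
      finally have "norm (x - a) powr \<eta> \<le> (real CARD('n) * l) powr \<eta>"
        using \<eta> by (intro powr_mono2) auto
      then show ?thesis using C(2)[of x a] mult_left_mono[OF _ C(1)] by (meson order_trans)
    qed
    then have "2 * (LINT x:cube a l|lebesgue. cmod (f x - f a)) / l ^ CARD('n)
        \<le> 2 * (C * (real CARD('n) * l) powr \<eta> * l ^ CARD('n)) / l ^ CARD('n)"
      using l by (intro divide_right_mono mult_left_mono set_integral_cube_le osc_integrable L) auto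
    then show ?thesis using mean_osc_le_integral[OF L l, of a "f a"] l by simp
  qed
  let ?S = "\<lambda>r. {mean_osc f (cube a l) |a l. 0 < l \<and> l \<le> r}"
  have bounds: "0 \<le> Sup (?S r) \<and> Sup (?S r) \<le> 2 * C * (real CARD('n) * r) powr \<eta>" if r: "0 < r" for r
  proof -
    have ub: "y \<le> 2 * C * (real CARD('n) * r) powr \<eta>" if y: "y \<in> ?S r" for y
    proof -
      obtain a l where al: "y = mean_osc f (cube a l)" "0 < l" "l \<le> r" using y by blast
      have "(real CARD('n) * l) powr \<eta> \<le> (real CARD('n) * r) powr \<eta>"
        using al \<eta> by (intro powr_mono2) auto
      then have "2 * C * (real CARD('n) * l) powr \<eta> \<le> 2 * C * (real CARD('n) * r) powr \<eta>"
        using C(1) by (intro mult_left_mono) auto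
      then show ?thesis using osc[OF al(2), of a] al(1) by linarith
    qed
    \<comment> \<open>Real suprema need a nonempty bounded set: this is the nonemptiness,
      \<open>ub\<close> the bound.\<close>
    have mem: "mean_osc f (cube 0 r) \<in> ?S r" using r by blast
    have "mean_osc f (cube 0 r) \<le> Sup (?S r)"
      using ub by (intro cSup_upper mem) (auto simp only: bdd_above_def)
    moreover have "Sup (?S r) \<le> 2 * C * (real CARD('n) * r) powr \<eta>"
      using mem by (intro cSup_least ub) blast
    ultimately show ?thesis using mean_osc_nonneg[of f] order_trans by blast
  qed
  have "((\<lambda>r. Sup (?S r)) \<longlongrightarrow> 0) (at_right 0)"
  proof (rule tendsto_sandwich)
    show "\<forall>\<^sub>F r in at_right 0. 0 \<le> Sup (?S r)"
      and "\<forall>\<^sub>F r in at_right 0. Sup (?S r) \<le> 2 * C * (real CARD('n) * r) powr \<eta>"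
      using bounds by (auto simp only: eventually_at_right_field intro!: exI[of _ 1] zero_less_one)
    have "((\<lambda>r. 2 * C * (real CARD('n) * r) powr \<eta>) \<longlongrightarrow> 2 * C * (real CARD('n) * 0) powr \<eta>) (at_right 0)"
      using \<eta> by (intro tendsto_mult tendsto_const tendsto_powr' tendsto_ident_at)
        (auto simp: eventually_at_right_field intro!: exI[of _ 1])
    then show "((\<lambda>r. 2 * C * (real CARD('n) * r) powr \<eta>) \<longlongrightarrow> 0) (at_right 0)" by simp
  qed simp
  then show ?thesis using b by (simp add: VMO_def)
qed

lemma VMO_small_osc:
  fixes f :: "real ^ 'n \<Rightarrow> complex"
  assumes f: "f \<in> VMO" and \<delta>: "0 < \<delta>"
  obtains r where "0 < r" "\<And>a l. 0 < l \<Longrightarrow> l \<le> r \<Longrightarrow> mean_osc f (cube a l) \<le> \<delta>"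
proof -
  let ?S = "\<lambda>r. {mean_osc f (cube a l) |a l. 0 < l \<and> l \<le> r}"
  have "((\<lambda>r. Sup (?S r)) \<longlongrightarrow> 0) (at_right 0)" using f by (simp add: VMO_def)
  then have "\<forall>\<^sub>F r in at_right 0. Sup (?S r) < \<delta>" using \<delta> by (rule order_tendstoD)
  then obtain b where b: "0 < b" "\<And>r. 0 < r \<Longrightarrow> r < b \<Longrightarrow> Sup (?S r) < \<delta>"
    by (auto simp: eventually_at_right_field)
  have "bdd_above {mean_osc f (cube a l) |a l. 0 < l}" using f by (simp add: VMO_def BMO_def)
  then have bdd: "bdd_above (?S r)" for r by (rule bdd_above_mono) blast
  \<comment> \<open>The limit controls the supremum only for radii strictly below \<open>b\<close>,
    hence \<open>b / 2\<close>.\<close>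
  have "mean_osc f (cube a l) \<le> \<delta>" if "0 < l" "l \<le> b / 2" for a l
  proof -
    have "mean_osc f (cube a l) \<le> Sup (?S (b / 2))" using that by (intro cSup_upper bdd) auto
    also have "\<dots> < \<delta>" using b by (intro b(2)) auto
    finally show ?thesis by simp
  qed
  then show ?thesis using that[of "b / 2"] b by simp
qed

section \<open>Density\<close>

lemma VMO_approx_Holder:
  fixes f :: "real ^ 'n \<Rightarrow> complex"
  assumes f: "f \<in> VMO" and \<eta>: "0 < \<eta>" "\<eta> < 1" and e: "0 < e"
  obtains g where "g \<in> Holder_hom \<eta>" "g \<in> BMO" "BMO_norm (\<lambda>x. f x - g x) < e"
proof -
  define B where "B = 2 * (6 ^ CARD('n) + mollify_const TYPE('n))"
  have B: "0 < B" unfolding B_def using mollify_const_pos[where 'n='n] by (simp add: add_pos_pos)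
  \<comment> \<open>The estimate for the difference multiplies by \<open>B\<close>, so the
    oscillations end up at most \<open>e / 2\<close>, and their supremum stays strictly below
    \<open>e\<close>.\<close>
  obtain r where r: "0 < r" "\<And>a l. 0 < l \<Longrightarrow> l \<le> r \<Longrightarrow> mean_osc f (cube a l) \<le> e / (2 * B)"
    using VMO_small_osc[OF f, of "e / (2 * B)"] e B by auto
  \<comment> \<open>At scale \<open>r / 3\<close> the oscillation of \<open>f\<close> is needed for
    sides up to three times the scale, that is, up to \<open>r\<close>.\<close>
  define g where "g = mollify f (r / 3)"
  have fB: "f \<in> BMO" using f by (simp add: VMO_def)
  then have L: "f \<in> L1_loc" by (simp add: BMO_def)
  have "mean_osc (\<lambda>x. f x - g x) (cube a l) \<le> B * (e / (2 * B))" if "0 < l" for a l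
    unfolding B_def g_def
    by (rule mean_osc_diff_mollify[OF L]) (use r that in \<open>auto simp: B_def\<close>)
  then have osc: "mean_osc (\<lambda>x. f x - g x) (cube a l) \<le> e / 2" if "0 < l" for a l
    using that B by simp
  have "g \<in> L1_loc" unfolding g_def using r by (intro continuous_imp_L1_loc mollify_continuous L) auto
  then have "(\<lambda>x. f x - g x) \<in> BMO"
    using osc L1_loc_diff[OF L] by (auto simp: BMO_def intro!: bdd_aboveI[where M = "e / 2"])
  \<comment> \<open>\<open>g\<close> is recovered as \<open>f\<close> minus
    \<open>f - g\<close>.\<close>
  from BMO_diff(1)[OF fB this] have "g \<in> BMO" by simp
  moreover have "BMO_norm (\<lambda>x. f x - g x) < e"
    using BMO_norm_least[OF osc] e by simp
  moreover have "g \<in> Holder_hom \<eta>"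
    unfolding g_def using r by (intro mollify_Holder fB \<eta>) auto
  ultimately show ?thesis using that by blast
qed

text \<open>The inclusion is a separate conjunct because \<open>closure_of\<close> ignores points
  outside the topspace, so the equation alone would not imply it.\<close>

theorem corollary1p11:
  fixes \<eta> :: real
  assumes "0 < \<eta>" and "\<eta> < 1"
  shows "Holder_tilde \<eta> \<inter> BMO_tilde \<subseteq> (VMO_tilde :: (real ^ 'n \<Rightarrow> complex) set set)
    \<and> subtopology BMO_tilde_topology VMO_tilde closure_of (Holder_tilde \<eta> \<inter> BMO_tilde)
      = (VMO_tilde :: (real ^ 'n \<Rightarrow> complex) set set)"
proof -
  interpret M: Metric_space "BMO_tilde :: (real ^ 'n \<Rightarrow> complex) set set" BMO_tilde_dist
    by (rule Metric_space_BMO_tilde)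
  have sub: "Holder_tilde \<eta> \<inter> BMO_tilde \<subseteq> (VMO_tilde :: (real ^ 'n \<Rightarrow> complex) set set)"
  proof
    fix X :: "(real ^ 'n \<Rightarrow> complex) set" assume "X \<in> Holder_tilde \<eta> \<inter> BMO_tilde"
    \<comment> \<open>The Hoelder and the BMO representative of the class may differ. BMO membership
      passes to the Hoelder one through \<open>ae_class g\<close>, to which it belongs once it is
      known to be measurable.\<close>
    then obtain f g where f: "f \<in> Holder_hom \<eta>" "X = ae_class f" and g: "g \<in> BMO" "X = ae_class g"
      by (auto simp: Holder_tilde_def BMO_tilde_def)
    have "f \<in> borel_measurable lebesgue"
      using continuous_imp_L1_loc[OF Holder_continuous[OF f(1) assms(1)]] by (rule L1_loc_measurable)
    then have "f \<in> ae_class g" using ae_class_self f(2) g(2) by blast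
    then have "f \<in> BMO" by (rule BMO_ae_class(1)[OF g(1)])
    then have "f \<in> VMO" by (intro Holder_BMO_imp_VMO[OF f(1)] assms)
    then show "X \<in> VMO_tilde" using f(2) by (simp add: VMO_tilde_def)
  qed
  have "VMO_tilde \<subseteq> M.mtopology closure_of (Holder_tilde \<eta> \<inter> BMO_tilde)"
  proof
    fix X :: "(real ^ 'n \<Rightarrow> complex) set" assume "X \<in> VMO_tilde"
    then obtain f where f: "f \<in> VMO" "X = ae_class f" by (auto simp: VMO_tilde_def)
    then have fB: "f \<in> BMO" by (simp add: VMO_def)
    have X: "X \<in> BMO_tilde" using f fB by (simp add: BMO_tilde_def)
    have "\<exists>Y\<in>Holder_tilde \<eta> \<inter> BMO_tilde. Y \<in> M.mball X e" if e: "0 < e" for e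
    proof -
      obtain g where g: "g \<in> Holder_hom \<eta>" "g \<in> BMO" "BMO_norm (\<lambda>x. f x - g x) < e"
        using VMO_approx_Holder[OF f(1) assms e] by blast
      have "ae_class g \<in> Holder_tilde \<eta> \<inter> BMO_tilde"
        using g by (simp add: Holder_tilde_def BMO_tilde_def)
      moreover from this have "ae_class g \<in> M.mball X e"
        using X g BMO_tilde_dist_class[OF fB g(2)] f(2) by (simp add: M.in_mball)
      ultimately show ?thesis by blast
    qed
    then show "X \<in> M.mtopology closure_of (Holder_tilde \<eta> \<inter> BMO_tilde)"
      using X by (simp add: M.metric_closure_of)
  qed
  then have "subtopology BMO_tilde_topology VMO_tilde closure_of (Holder_tilde \<eta> \<inter> BMO_tilde)
      = (VMO_tilde :: (real ^ 'n \<Rightarrow> complex) set set)"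
    using sub by (simp add: closure_of_subtopology BMO_tilde_topology_def Int_absorb1 Int_absorb2)
  with sub show ?thesis ..
qed

end
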